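(* Let $m\ge 3$ be an integer, $n=2^m-3$, and let $C_1\subset V(H^n)$ be an $(n,2^{2^m-m-3},3)$ code. Then there is exactly one twofold $1$-perfect code $D\subset V(H^{n+2})$ (a multiset) that contains the set $C_100=\{\bar x00\mid\bar x\in C_1\}$ and all of whose codewords $\bar x$ satisfy $\bar x+0\ldots011\in D$.
   Context: $H^n$ is the graph (hypercube) whose vertex set $V(H^n)$ is the set of all binary words of length $n$, two words being adjacent iff they differ in exactly one position. $d(\cdot,\cdot)$ is the Hamming distance; addition of words is coordinatewise modulo $2$; $0\ldots011$ is the word with ones exactly in the last two positions. For $\bar x=x_1\ldots x_n$, $\bar x00$ denotes the word $x_1\ldots x_n00$ of length $n+2$. An $(n,|C|,d)$ code is a subset $C\subset V(H^n)$ such that $d(\bar x,\bar y)\ge d$ for any two different $\bar x,\bar y\in C$. A twofold $1$-perfect code in $V(H^N)$ is a multiset $B$ of words of $V(H^N)$ such that every vertex $\bar x\in V(H^N)$ is at distance $0$ or $1$ from exactly two codewords of $B$ (counted with multiplicity). *)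

theory Defs
  imports "HOL-Library.Multiset" "HOL-Library.Z2"
begin

definition words :: "nat \<Rightarrow> bit list set" where
  "words n = {x. length x = n}"

text \<open>Only meaningful for words of equal length.\<close>

definition hamming :: "bit list \<Rightarrow> bit list \<Rightarrow> nat" where
  "hamming x y = card {i. i < length x \<and> x ! i \<noteq> y ! i}"

text \<open>Coordinatewise; addition on \<^typ>\<open>bit\<close> is addition modulo 2.\<close>

definition word_add :: "bit list \<Rightarrow> bit list \<Rightarrow> bit list" where
  "word_add x y = map2 (+) x y"

definition is_code :: "nat \<Rightarrow> nat \<Rightarrow> nat \<Rightarrow> bit list set \<Rightarrow> bool" where
  "is_code n M d C \<longleftrightarrow>
     C \<subseteq> words n \<and> card C = M \<and> (\<forall>x\<in>C. \<forall>y\<in>C. x \<noteq> y \<longrightarrow> d \<le> hamming x y)"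

definition twofold_perfect_code :: "nat \<Rightarrow> bit list multiset \<Rightarrow> bool" where
  "twofold_perfect_code N B \<longleftrightarrow>
     set_mset B \<subseteq> words N \<and> (\<forall>x\<in>words N. size {#y \<in># B. hamming x y \<le> 1#} = 2)"

end

theory Submission imports Defs
begin

text \<open>
  Let \<open>S f x\<close> be the sum of \<open>f\<close> over the radius-1 ball around \<open>x\<close>, let \<open>T\<close> be the antipodal map
  (every bit is complemented), and let \<open>f\<close> be the indicator function of the code \<open>C1\<close>.

  The code has the largest size that a certain linear programming bound allows, and this makes it
  rigid. The operator \<open>S\<^sup>2 - 2 - 2 T\<close> is diagonal in the basis of Walsh functions; on a Walsh function
  of weight \<open>w\<close> its eigenvalue is \<open>(n + 1 - 2 w)\<^sup>2 - 2 - 2 (- 1)\<^sup>w\<close>. Because \<open>n\<close> is 1 modulo 4, the number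
  \<open>n + 1 - 2 w\<close> is 2 modulo 4 for even \<open>w\<close>, so that all these eigenvalues are nonnegative
  (\<open>spectral_gap\<close>). The distance of the code gives \<open>S f \<le> 1\<close> and so bounds the quadratic form of the
  operator at \<open>f\<close> from above by \<open>(n - 1) |C1|\<close>. For a code with \<open>(n + 3) |C1| = 2\<^sup>n\<close> the constant
  component of \<open>f\<close> alone contributes this much, so the other components lie in the kernel, that is,
  \<open>S (S f) = 2 f + 2 T f + (n - 1)\<close> (\<open>ball_sum_twice_extremal\<close>).

  With \<open>g = 1 - S f\<close>, the indicator function of the words not covered by \<open>C1\<close>, and \<open>a = f + T f\<close>,
  the identity becomes \<open>S g + 2 a = 2\<close>; it also implies that \<open>g\<close> is invariant under \<open>T\<close>, and
  this turns into \<open>S a + 2 g = 2\<close> (\<open>uncovered_and_antipodal_pair\<close>). These two equations say exactly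
  that appending 00 and 11 to the words with \<open>a = 1\<close>, and 01 and 10 to the words with \<open>g = 1\<close>, gives
  a twofold 1-perfect code.

  For uniqueness, invariance under adding \<open>0\<dots>011\<close> forces every such code to have multiplicities \<open>\<alpha>\<close>
  on the layers 00 and 11 and \<open>\<gamma>\<close> on the layers 01 and 10, where \<open>(\<alpha>, \<gamma>)\<close> solves the same pair of
  equations. Summing the equations shows that \<open>\<gamma>\<close> and \<open>g\<close> have the same total, while \<open>\<alpha> \<ge> f\<close> gives
  \<open>\<gamma> \<le> g\<close>. Hence \<open>\<gamma> = g\<close>, and then the second equation determines \<open>\<alpha>\<close>
  (\<open>count_of_twofold_code\<close>).
\<close>

section \<open>Flips, antipodes and sums over balls\<close>

definition flip :: "nat \<Rightarrow> bit list \<Rightarrow> bit list" where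
  "flip i x = x[i := x ! i + 1]"

definition antipode :: "bit list \<Rightarrow> bit list" where
  "antipode x = map (\<lambda>b. b + 1) x"

definition ball_sum :: "(bit list \<Rightarrow> int) \<Rightarrow> bit list \<Rightarrow> int" where
  "ball_sum f x = f x + (\<Sum>i<length x. f (flip i x))"

lemma bit_add_one_twice [simp]: "(b::bit) + 1 + 1 = b"
  by (simp add: add.assoc)

lemma bit_add_one_neq [simp]: "(b::bit) + 1 \<noteq> b" "b \<noteq> b + 1"
  by (cases b; simp)+

lemma bit_neq_iff_add_one: "(a::bit) \<noteq> b \<longleftrightarrow> b = a + 1"
  by (cases a; cases b) auto

lemma length_flip [simp]: "length (flip i x) = length x"
  by (simp add: flip_def)

lemma length_antipode [simp]: "length (antipode x) = length x"
  by (simp add: antipode_def)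

lemma flip_in_words [simp]: "flip i x \<in> words n \<longleftrightarrow> x \<in> words n"
  by (simp add: words_def)

lemma antipode_in_words [simp]: "antipode x \<in> words n \<longleftrightarrow> x \<in> words n"
  by (simp add: words_def)

lemma flip_nth: "j < length x \<Longrightarrow> flip i x ! j = (if i = j then x ! j + 1 else x ! j)"
  by (simp add: flip_def)

lemma antipode_nth: "j < length x \<Longrightarrow> antipode x ! j = x ! j + 1"
  by (simp add: antipode_def)

lemma flip_flip [simp]: "flip i (flip i x) = x"
  by (intro nth_equalityI) (auto simp: flip_nth)

lemma antipode_antipode [simp]: "antipode (antipode x) = x"
  by (intro nth_equalityI) (auto simp: antipode_nth)

lemma antipode_flip: "antipode (flip i x) = flip i (antipode x)"
  by (intro nth_equalityI) (auto simp: flip_nth antipode_nth)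

lemma flip_append:
  "i < length x \<Longrightarrow> flip i (x @ y) = flip i x @ y"
  "flip (length x) (x @ p # y) = x @ (p + 1) # y"
  "flip (Suc (length x)) (x @ p # q # y) = x @ p # (q + 1) # y"
  by (simp_all add: flip_def list_update_append nth_append)

lemma UNIV_bit: "(UNIV :: bit set) = {0, 1}"
proof -
  have "b \<in> {0, 1}" for b :: bit by (cases b) simp_all
  then show ?thesis by blast
qed

lemma finite_words [simp]: "finite (words n)"
proof -
  have "finite {x :: bit list. set x \<subseteq> UNIV \<and> length x = n}"
    by (rule finite_lists_length_eq) (simp add: UNIV_bit)
  then show ?thesis by (simp add: words_def)
qed

lemma card_words: "card (words n) = 2 ^ n"
proof -
  have "card {x :: bit list. set x \<subseteq> UNIV \<and> length x = n} = card (UNIV :: bit set) ^ n"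
    by (rule card_lists_length_eq) (simp add: UNIV_bit)
  moreover have "card (UNIV :: bit set) = 2" by (simp add: UNIV_bit)
  ultimately show ?thesis by (simp add: words_def)
qed

lemma sum_flip: "(\<Sum>x\<in>words n. f (flip i x)) = (\<Sum>x\<in>words n. f x)"
  by (rule sum.reindex_bij_witness[where i = "flip i" and j = "flip i"]) auto

lemma sum_antipode: "(\<Sum>x\<in>words n. f (antipode x)) = (\<Sum>x\<in>words n. f x)"
  by (rule sum.reindex_bij_witness[where i = antipode and j = antipode]) auto

lemma ball_sum_words:
  "x \<in> words n \<Longrightarrow> ball_sum f x = f x + (\<Sum>i<n. f (flip i x))"
  by (simp add: ball_sum_def words_def)

lemma ball_sum_cong:
  "(\<And>y. y \<in> words n \<Longrightarrow> f y = g y) \<Longrightarrow> x \<in> words n \<Longrightarrow> ball_sum f x = ball_sum g x"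
  by (simp add: ball_sum_words)

lemma ball_sum_add: "ball_sum (\<lambda>x. f x + g x) x = ball_sum f x + ball_sum g x"
  by (simp add: ball_sum_def sum.distrib)

lemma ball_sum_diff: "ball_sum (\<lambda>x. f x - g x) x = ball_sum f x - ball_sum g x"
  by (simp add: ball_sum_def sum_subtractf)

lemma ball_sum_const: "x \<in> words n \<Longrightarrow> ball_sum (\<lambda>_. c) x = (int n + 1) * c"
  by (simp add: ball_sum_words algebra_simps)

lemma ball_sum_antipode: "ball_sum (\<lambda>x. f (antipode x)) x = ball_sum f (antipode x)"
  by (simp add: ball_sum_def antipode_flip)

lemma ball_sum_nonneg: "(\<And>y. 0 \<le> f y) \<Longrightarrow> 0 \<le> ball_sum f x"
  by (simp add: ball_sum_def sum_nonneg)

lemma ball_sum_mono: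
  "(\<And>y. y \<in> words n \<Longrightarrow> f y \<le> g y) \<Longrightarrow> x \<in> words n \<Longrightarrow> ball_sum f x \<le> ball_sum g x"
  by (simp add: ball_sum_words add_mono sum_mono)

lemma ball_sum_self_adjoint:
  "(\<Sum>x\<in>words n. f x * ball_sum g x) = (\<Sum>x\<in>words n. ball_sum f x * g x)"
proof -
  have "(\<Sum>x\<in>words n. f x * ball_sum g x)
      = (\<Sum>x\<in>words n. f x * g x) + (\<Sum>i<n. \<Sum>x\<in>words n. f x * g (flip i x))"
    by (subst sum.swap)
      (simp add: ball_sum_words distrib_left sum.distrib sum_distrib_left)
  also have "(\<Sum>i<n. \<Sum>x\<in>words n. f x * g (flip i x))
      = (\<Sum>i<n. \<Sum>x\<in>words n. f (flip i x) * g x)"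
  proof (rule sum.cong[OF refl])
    fix i
    show "(\<Sum>x\<in>words n. f x * g (flip i x)) = (\<Sum>x\<in>words n. f (flip i x) * g x)"
      using sum_flip[of "\<lambda>x. f (flip i x) * g x" i n] by simp
  qed
  also have "(\<Sum>x\<in>words n. f x * g x) + \<dots> = (\<Sum>x\<in>words n. ball_sum f x * g x)"
    by (subst sum.swap)
      (simp add: ball_sum_words distrib_right sum.distrib sum_distrib_right)
  finally show ?thesis .
qed

lemma sum_ball_sum: "(\<Sum>x\<in>words n. ball_sum f x) = (int n + 1) * (\<Sum>x\<in>words n. f x)"
proof -
  have "(\<Sum>x\<in>words n. ball_sum f x) = (\<Sum>x\<in>words n. 1 * ball_sum f x)" by simp
  also have "\<dots> = (\<Sum>x\<in>words n. ball_sum (\<lambda>_. 1) x * f x)"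
    by (rule ball_sum_self_adjoint)
  also have "\<dots> = (int n + 1) * (\<Sum>x\<in>words n. f x)"
    by (simp add: ball_sum_const sum_distrib_left)
  finally show ?thesis .
qed

text \<open>
  A self-adjoint operator and its square have the same kernel: the inner product of \<open>f\<close> with
  \<open>S (S f)\<close> is the squared norm of \<open>S f\<close>.
\<close>

lemma ball_sum_eq_0_if_ball_sum_twice_eq_0:
  assumes "\<And>x. x \<in> words n \<Longrightarrow> ball_sum (ball_sum f) x = 0" and "x \<in> words n"
  shows "ball_sum f x = 0"
proof -
  have "(\<Sum>x\<in>words n. ball_sum f x * ball_sum f x) = (\<Sum>x\<in>words n. f x * ball_sum (ball_sum f) x)"
    by (simp add: ball_sum_self_adjoint)
  also have "\<dots> = 0" by (simp add: assms(1))
  finally have "\<forall>x\<in>words n. ball_sum f x * ball_sum f x = 0"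
    by (subst (asm) sum_nonneg_eq_0_iff) auto
  then show ?thesis using assms(2) by simp
qed

lemma hamming_le_1_iff:
  assumes "x \<in> words n" "y \<in> words n"
  shows "hamming x y \<le> 1 \<longleftrightarrow> y = x \<or> (\<exists>i<n. y = flip i x)"
proof -
  have len: "length x = n" "length y = n" using assms by (auto simp: words_def)
  let ?D = "{i. i < n \<and> x ! i \<noteq> y ! i}"
  show ?thesis
  proof
    assume "hamming x y \<le> 1"
    then have one: "\<And>i j. i \<in> ?D \<Longrightarrow> j \<in> ?D \<Longrightarrow> i = j"
      using card_le_Suc0_iff_eq[of ?D] by (simp add: hamming_def len)
    show "y = x \<or> (\<exists>i<n. y = flip i x)"
    proof (cases "?D = {}")
      case True
      then have "y = x" by (intro nth_equalityI) (auto simp: len)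
      then show ?thesis by blast
    next
      case False
      then obtain i where i: "i \<in> ?D" by blast
      have "y = flip i x"
      proof (rule nth_equalityI)
        fix j assume "j < length y"
        then have j: "j < n" by (simp add: len)
        show "y ! j = flip i x ! j"
        proof (cases "i = j")
          case True
          then show ?thesis
            using i bit_neq_iff_add_one[of "x ! i" "y ! i"] by (simp add: flip_nth len)
        next
          case False
          then have "x ! j = y ! j" using one[of i j] i j by blast
          then show ?thesis using False j by (simp add: flip_nth len)
        qed
      qed (simp add: len)
      then show ?thesis using i by auto
    qed
  next
    assume "y = x \<or> (\<exists>i<n. y = flip i x)"
    then have "\<exists>i. ?D \<subseteq> {i}" by (auto simp: flip_nth len split: if_splits)
    then obtain i where "?D \<subseteq> {i}" by blast
    then have "card ?D \<le> card {i}" by (rule card_mono[rotated]) simp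
    then show "hamming x y \<le> 1" by (simp add: hamming_def len)
  qed
qed

lemma flip_neq: "i < length x \<Longrightarrow> flip i x \<noteq> x"
proof
  assume "i < length x" "flip i x = x"
  then have "x ! i + 1 = x ! i" by (metis flip_nth)
  then show False by (rule notE[OF bit_add_one_neq(1)])
qed

lemma flip_eq_flip_iff: "i < length x \<Longrightarrow> flip i x = flip j x \<longleftrightarrow> i = j"
proof
  assume i: "i < length x" and eq: "flip i x = flip j x"
  show "i = j"
  proof (rule ccontr)
    assume "i \<noteq> j"
    then have "flip i x ! i = x ! i + 1" "flip j x ! i = x ! i"
      using i by (simp_all add: flip_nth)
    then have "x ! i + 1 = x ! i" by (metis eq)
    then show False by (rule notE[OF bit_add_one_neq(1)])
  qed
qed simp

text \<open>
  The link between Hamming balls, in which codes are specified, and sums over coordinate flips, in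
  which the Walsh functions are eigenvectors.
\<close>

lemma sum_over_ball:
  assumes "x \<in> words n"
  shows "(\<Sum>y\<in>{y \<in> words n. hamming x y \<le> 1}. f y) = ball_sum f x"
proof -
  have len: "length x = n" using assms by (simp add: words_def)
  have "{y \<in> words n. hamming x y \<le> 1} = insert x ((\<lambda>i. flip i x) ` {..<n})"
    using hamming_le_1_iff[OF assms] assms by auto
  moreover have "x \<notin> (\<lambda>i. flip i x) ` {..<n}"
    using flip_neq[of _ x] len by (metis imageE lessThan_iff)
  moreover have "inj_on (\<lambda>i. flip i x) {..<n}"
    by (intro inj_onI) (simp add: flip_eq_flip_iff len)
  ultimately show ?thesis
    using assms by (simp add: ball_sum_words sum.reindex)
qed

lemma hamming_triangle:
  assumes "x \<in> words n" "y \<in> words n" "z \<in> words n"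
  shows "hamming y z \<le> hamming x y + hamming x z"
proof -
  have "{i. i < n \<and> y ! i \<noteq> z ! i} \<subseteq> {i. i < n \<and> x ! i \<noteq> y ! i} \<union> {i. i < n \<and> x ! i \<noteq> z ! i}"
    by auto
  then have "card {i. i < n \<and> y ! i \<noteq> z ! i}
      \<le> card ({i. i < n \<and> x ! i \<noteq> y ! i} \<union> {i. i < n \<and> x ! i \<noteq> z ! i})"
    by (rule card_mono[rotated]) simp
  also have "\<dots> \<le> card {i. i < n \<and> x ! i \<noteq> y ! i} + card {i. i < n \<and> x ! i \<noteq> z ! i}"
    by (rule card_Un_le)
  finally show ?thesis using assms by (simp add: hamming_def words_def)
qed

section \<open>Fourier analysis on the cube\<close>

definition bit_sign :: "bit \<Rightarrow> int" where
  "bit_sign b = (if b = 1 then - 1 else 1)"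

definition walsh :: "bit list \<Rightarrow> bit list \<Rightarrow> int" where
  "walsh u x = (\<Prod>i<length x. if u ! i = 1 then bit_sign (x ! i) else 1)"

text \<open>
  The transform is not normalized, which keeps all values integral; the factor \<open>2\<^sup>n\<close> appears in
  \<open>parseval\<close> instead.
\<close>

definition fourier :: "nat \<Rightarrow> (bit list \<Rightarrow> int) \<Rightarrow> bit list \<Rightarrow> int" where
  "fourier n f u = (\<Sum>x\<in>words n. walsh u x * f x)"

text \<open>
  The eigenvalues, at the Walsh function of \<open>u\<close>, of the ball-sum operator and of the antipodal map.
\<close>

definition ball_eigenvalue :: "bit list \<Rightarrow> int" where
  "ball_eigenvalue u = 1 + (\<Sum>i<length u. bit_sign (u ! i))"

definition parity_sign :: "bit list \<Rightarrow> int" where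
  "parity_sign u = (\<Prod>i<length u. bit_sign (u ! i))"

lemma bit_sign_add_one [simp]: "bit_sign (b + 1) = - bit_sign b"
  by (simp add: bit_sign_def)

lemma walsh_commute: "length u = length x \<Longrightarrow> walsh u x = walsh x u"
  unfolding walsh_def by (intro prod.cong) (auto simp: bit_sign_def)

lemma walsh_square: "walsh u x * walsh u x = 1"
  unfolding walsh_def by (simp flip: prod.distrib) (intro prod.neutral, auto simp: bit_sign_def)

lemma walsh_flip:
  assumes "i < length x"
  shows "walsh u (flip i x) = bit_sign (u ! i) * walsh u x"
proof -
  have "walsh u (flip i x)
      = (\<Prod>j<length x. (if i = j then bit_sign (u ! j) else 1) *
          (if u ! j = 1 then bit_sign (x ! j) else 1))"
    unfolding walsh_def by (intro prod.cong) (auto simp: flip_nth bit_sign_def)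
  also have "\<dots> = bit_sign (u ! i) * walsh u x"
    using assms by (simp add: prod.distrib walsh_def)
  finally show ?thesis .
qed

lemma walsh_antipode:
  assumes "length u = length x"
  shows "walsh u (antipode x) = parity_sign u * walsh u x"
  unfolding walsh_def parity_sign_def assms length_antipode prod.distrib[symmetric]
  by (intro prod.cong) (auto simp: antipode_nth bit_sign_def)

text \<open>
  For distinct words the sum vanishes because flipping \<open>u\<close> in a position where the words differ
  changes the sign of every summand.
\<close>

lemma walsh_orthogonal:
  assumes "x \<in> words n" "y \<in> words n"
  shows "(\<Sum>u\<in>words n. walsh u x * walsh u y) = (if x = y then 2 ^ n else 0)"
proof (cases "x = y")
  case True
  then show ?thesis by (simp add: walsh_square card_words)
next
  case False
  have len: "length x = n" "length y = n" using assms by (auto simp: words_def)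
  then obtain i where i: "i < n" "x ! i \<noteq> y ! i" using False by (metis nth_equalityI)
  let ?s = "\<Sum>u\<in>words n. walsh u x * walsh u y"
  have "?s = (\<Sum>u\<in>words n. walsh (flip i u) x * walsh (flip i u) y)"
    by (rule sum_flip[symmetric])
  also have "\<dots> = (\<Sum>u\<in>words n. - (walsh u x * walsh u y))"
  proof (rule sum.cong[OF refl])
    fix u assume "u \<in> words n"
    then have u: "length u = n" by (simp add: words_def)
    have *: "walsh (flip i u) z = bit_sign (z ! i) * walsh u z" if "length z = n" for z
      using walsh_flip[of i u z] walsh_commute[of z u] walsh_commute[of z "flip i u"] u that i(1)
      by simp
    have "walsh (flip i u) x * walsh (flip i u) y
        = bit_sign (x ! i) * bit_sign (y ! i) * (walsh u x * walsh u y)"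
      by (simp only: * len ac_simps)
    moreover have "bit_sign (x ! i) * bit_sign (y ! i) = - 1"
      using i(2) by (cases "x ! i"; cases "y ! i") (auto simp: bit_sign_def)
    ultimately show "walsh (flip i u) x * walsh (flip i u) y = - (walsh u x * walsh u y)"
      by simp
  qed
  also have "\<dots> = - ?s" by (rule sum_negf)
  finally show ?thesis using False by simp
qed

lemma parseval:
  "(\<Sum>u\<in>words n. fourier n f u * fourier n g u) = 2 ^ n * (\<Sum>x\<in>words n. f x * g x)"
proof -
  have "(\<Sum>u\<in>words n. fourier n f u * fourier n g u)
      = (\<Sum>u\<in>words n. \<Sum>x\<in>words n. \<Sum>y\<in>words n. f x * g y * (walsh u x * walsh u y))"
    unfolding fourier_def sum_product by (intro sum.cong refl) (simp only: ac_simps)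
  also have "\<dots> = (\<Sum>x\<in>words n. \<Sum>u\<in>words n. \<Sum>y\<in>words n. f x * g y * (walsh u x * walsh u y))"
    by (rule sum.swap)
  also have "\<dots> = (\<Sum>x\<in>words n. \<Sum>y\<in>words n. \<Sum>u\<in>words n. f x * g y * (walsh u x * walsh u y))"
    by (intro sum.cong[OF refl] sum.swap)
  also have "\<dots> = (\<Sum>x\<in>words n. \<Sum>y\<in>words n. if x = y then f x * g y * 2 ^ n else 0)"
    by (intro sum.cong refl) (simp add: walsh_orthogonal flip: sum_distrib_left)
  also have "\<dots> = (\<Sum>x\<in>words n. f x * g x * 2 ^ n)"
    by (intro sum.cong refl) simp
  also have "\<dots> = 2 ^ n * (\<Sum>x\<in>words n. f x * g x)"
    by (simp only: mult.commute sum_distrib_left)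
  finally show ?thesis .
qed

lemma fourier_ball_sum:
  assumes "u \<in> words n"
  shows "fourier n (ball_sum f) u = ball_eigenvalue u * fourier n f u"
proof -
  have "ball_sum (walsh u) x = ball_eigenvalue u * walsh u x" if "x \<in> words n" for x
    using assms that
    by (simp add: ball_sum_def words_def walsh_flip ball_eigenvalue_def distrib_right sum_distrib_right)
  then show ?thesis
    by (simp add: fourier_def ball_sum_self_adjoint sum_distrib_left mult.assoc)
qed

lemma fourier_antipode:
  assumes "u \<in> words n"
  shows "fourier n (\<lambda>x. f (antipode x)) u = parity_sign u * fourier n f u"
proof -
  have "fourier n (\<lambda>x. f (antipode x)) u = (\<Sum>x\<in>words n. walsh u (antipode x) * f x)"
    using sum_antipode[of "\<lambda>x. walsh u (antipode x) * f x" n] by (simp add: fourier_def)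
  also have "\<dots> = (\<Sum>x\<in>words n. parity_sign u * (walsh u x * f x))"
    using assms by (intro sum.cong) (auto simp: walsh_antipode words_def)
  finally show ?thesis by (simp add: fourier_def sum_distrib_left)
qed

lemma fourier_combine:
  "fourier n (\<lambda>x. f x - 2 * g x - 2 * h x) u = fourier n f u - 2 * fourier n g u - 2 * fourier n h u"
  by (simp add: fourier_def right_diff_distrib sum_subtractf sum_distrib_left ac_simps)

lemma ball_eigenvalue_parity_sign:
  assumes "u \<in> words n"
  shows "\<exists>w. ball_eigenvalue u = int n + 1 - 2 * int w \<and> parity_sign u = (- 1) ^ w"
proof -
  let ?O = "{i. i < n \<and> u ! i = 1}"
  have len: "length u = n" using assms by (simp add: words_def)
  have "(\<Sum>i<n. bit_sign (u ! i)) = (\<Sum>i<n. 1 - 2 * of_bool (u ! i = 1))"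
    by (intro sum.cong) (auto simp: bit_sign_def)
  also have "\<dots> = int n - 2 * int (card ?O)"
    by (simp add: sum_subtractf flip: sum_distrib_left)
       (simp add: lessThan_def Collect_conj_eq[symmetric])
  finally have "ball_eigenvalue u = int n + 1 - 2 * int (card ?O)"
    by (simp add: ball_eigenvalue_def len)
  moreover have "parity_sign u = (- 1) ^ card ?O"
    by (simp add: parity_sign_def len bit_sign_def prod.If_cases)
       (simp add: lessThan_def Collect_conj_eq[symmetric])
  ultimately show ?thesis by blast
qed

text \<open>
  This is the integrality that drives the proof. For even weight \<open>w\<close> the eigenvalue
  \<open>n + 1 - 2 w\<close> is 2 modulo 4, so its square is at least 4, which is the amount subtracted; for odd
  weight the subtracted amount is 0.
\<close>

lemma spectral_gap:
  assumes "u \<in> words n" and "n mod 4 = 1"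
  shows "0 \<le> ball_eigenvalue u ^ 2 - 2 - 2 * parity_sign u"
proof -
  obtain w where w: "ball_eigenvalue u = int n + 1 - 2 * int w" "parity_sign u = (- 1) ^ w"
    using ball_eigenvalue_parity_sign[OF assms(1)] by blast
  show ?thesis
  proof (cases "even w")
    case True
    then obtain v where v: "w = 2 * v" by (elim evenE)
    have "(int n + 1 - 4 * int v) \<noteq> 0" "(int n + 1 - 4 * int v) \<noteq> 1" "(int n + 1 - 4 * int v) \<noteq> - 1"
      using assms(2) by presburger+
    then have "2 \<le> \<bar>ball_eigenvalue u\<bar>" using w(1) v by simp
    then have "2 ^ 2 \<le> \<bar>ball_eigenvalue u\<bar> ^ 2" by (rule power_mono) simp
    then show ?thesis using w(2) True by simp
  next
    case False
    then show ?thesis using w(2) by simp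
  qed
qed

section \<open>Codes attaining the bound\<close>

text \<open>
  Equality in the linear programming bound. The quadratic form \<open>\<langle>f, h\<rangle>\<close> with
  \<open>h = S (S f) - 2 f - 2 T f\<close> is a nonnegative combination of the squared Fourier coefficients of
  \<open>f\<close>. The size condition makes the term of the zero word as large as the packing condition lets the
  whole form be, so all other coefficients of \<open>h\<close> vanish and \<open>h\<close> is constant.
\<close>

lemma ball_sum_twice_extremal:
  assumes n: "n mod 4 = 1"
    and f01: "\<And>x. x \<in> words n \<Longrightarrow> f x = 0 \<or> f x = 1"
    and packing: "\<And>x. x \<in> words n \<Longrightarrow> ball_sum f x \<le> 1"
    and size: "(int n + 3) * (\<Sum>x\<in>words n. f x) = 2 ^ n"
    and x: "x \<in> words n"
  shows "ball_sum (ball_sum f) x = 2 * f x + 2 * f (antipode x) + (int n - 1)"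
proof -
  define s where "s = (\<Sum>x\<in>words n. f x)"
  define h where "h = (\<lambda>x. ball_sum (ball_sum f) x - 2 * f x - 2 * f (antipode x))"
  define P where "P = (\<lambda>u. ball_eigenvalue u ^ 2 - 2 - 2 * parity_sign u)"
  define z :: "bit list" where "z = replicate n 0"
  let ?F = "fourier n f"
  have z: "z \<in> words n" by (simp add: z_def words_def)
  have Pz: "P z = (int n - 1) * (int n + 3)"
    by (simp add: P_def z_def ball_eigenvalue_def parity_sign_def bit_sign_def
        power2_eq_square algebra_simps)
  have walsh_z: "walsh z y = 1" if "y \<in> words n" for y
    using that by (simp add: walsh_def z_def words_def)
  have Fz: "?F z = s" by (simp add: fourier_def s_def walsh_z)
  have fourier_h: "fourier n h u = P u * ?F u" if "u \<in> words n" for u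
    unfolding h_def fourier_combine fourier_ball_sum[OF that] fourier_antipode[OF that] P_def
    by (simp add: power2_eq_square algebra_simps)
  have P_nonneg: "0 \<le> P u" if "u \<in> words n" for u
    unfolding P_def by (rule spectral_gap[OF that n])
  have Pz_s: "P z * s = (int n - 1) * 2 ^ n"
    by (simp add: Pz s_def mult.assoc size)

  \<comment> \<open>Upper bound: balls around codewords are disjoint, so \<open>S f\<close> equals its own square.\<close>
  have "(\<Sum>x\<in>words n. f x * ball_sum (ball_sum f) x) = (\<Sum>x\<in>words n. ball_sum f x)"
  proof -
    have "ball_sum f x * ball_sum f x = ball_sum f x" if "x \<in> words n" for x
    proof -
      have "0 \<le> f y" if "y \<in> words n" for y using f01[OF that] by auto
      then have "ball_sum (\<lambda>_. 0) x \<le> ball_sum f x"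
        using that by (intro ball_sum_mono)
      then have "ball_sum f x = 0 \<or> ball_sum f x = 1"
        using packing[OF that] ball_sum_const[OF that, of 0] by auto
      then show ?thesis by auto
    qed
    then show ?thesis by (subst ball_sum_self_adjoint) (intro sum.cong refl)
  qed
  moreover have "(\<Sum>x\<in>words n. f x * f x) = s"
    unfolding s_def by (intro sum.cong refl) (use f01 in auto)
  moreover have "0 \<le> (\<Sum>x\<in>words n. f x * f (antipode x))"
  proof (rule sum_nonneg)
    fix y assume "y \<in> words n"
    then show "0 \<le> f y * f (antipode y)"
      using f01[of y] f01[of "antipode y"] by auto
  qed
  moreover have "(\<Sum>x\<in>words n. f x * h x) = (\<Sum>x\<in>words n. f x * ball_sum (ball_sum f) x)
      - 2 * (\<Sum>x\<in>words n. f x * f x) - 2 * (\<Sum>x\<in>words n. f x * f (antipode x))"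
    by (simp add: h_def right_diff_distrib sum_subtractf sum_distrib_left mult.left_commute)
  ultimately have "(\<Sum>x\<in>words n. f x * h x) \<le> (int n - 1) * s"
    by (simp add: sum_ball_sum s_def algebra_simps)
  \<comment> \<open>Lower bound: by Parseval, already the term at \<open>z\<close> attains the upper bound.\<close>
  then have "2 ^ n * (\<Sum>x\<in>words n. f x * h x) \<le> 2 ^ n * ((int n - 1) * s)"
    by (rule mult_left_mono) simp
  then have "(\<Sum>u\<in>words n. ?F u * fourier n h u) \<le> P z * s * s"
    unfolding parseval Pz_s by (simp add: mult_ac)
  moreover have "(\<Sum>u\<in>words n. ?F u * fourier n h u)
      = P z * s * s + (\<Sum>u\<in>words n - {z}. P u * (?F u * ?F u))"
    by (subst sum.remove[OF finite_words z]) (simp add: fourier_h z Fz mult_ac)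
  ultimately have "(\<Sum>u\<in>words n - {z}. P u * (?F u * ?F u)) \<le> 0"
    by simp
  moreover have "0 \<le> P u * (?F u * ?F u)" if "u \<in> words n - {z}" for u
    using that P_nonneg by simp
  ultimately have "\<forall>u\<in>words n - {z}. P u * (?F u * ?F u) = 0"
    by (metis (no_types, lifting) finite_Diff finite_words order_antisym sum_nonneg
        sum_nonneg_eq_0_iff)
  then have h0: "fourier n h u = 0" if "u \<in> words n - {z}" for u
    using that fourier_h by auto

  \<comment> \<open>The sum and the sum of squares of \<open>h\<close> are those of the constant \<open>n - 1\<close>, so \<open>h\<close> has zero
    variance.\<close>
  have hz: "fourier n h z = (int n - 1) * 2 ^ n"
    using fourier_h[OF z] by (simp add: Fz Pz_s)
  have "2 ^ n * (\<Sum>x\<in>words n. h x * h x) = fourier n h z * fourier n h z"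
    by (subst parseval[symmetric], subst sum.remove[OF finite_words z]) (simp add: h0)
  then have "2 ^ n * (\<Sum>x\<in>words n. h x * h x) = 2 ^ n * ((int n - 1) * (int n - 1) * 2 ^ n)"
    unfolding hz by (simp add: mult_ac)
  then have hh: "(\<Sum>x\<in>words n. h x * h x) = (int n - 1) * (int n - 1) * 2 ^ n"
    by simp
  have h1: "(\<Sum>x\<in>words n. h x) = (int n - 1) * 2 ^ n"
    using hz by (simp add: fourier_def walsh_z)
  have "(\<Sum>x\<in>words n. (h x - (int n - 1)) ^ 2)
      = (\<Sum>x\<in>words n. h x * h x) - 2 * (int n - 1) * (\<Sum>x\<in>words n. h x)
        + (int n - 1) * (int n - 1) * 2 ^ n"
    by (simp add: power2_eq_square left_diff_distrib right_diff_distrib sum.distrib sum_subtractf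
        sum_distrib_left card_words algebra_simps)
  also have "\<dots> = 0" by (simp add: hh h1)
  finally have "\<forall>x\<in>words n. (h x - (int n - 1)) ^ 2 = 0"
    by (subst (asm) sum_nonneg_eq_0_iff) auto
  then have "h x = int n - 1" using x by simp
  then show ?thesis by (simp add: h_def)
qed

text \<open>
  The identity says that \<open>S (S f)\<close> is invariant under the antipodal map. So \<open>S\<^sup>2\<close> annihilates
  \<open>d = f - T f\<close>, and therefore \<open>S\<close> does: \<open>S f\<close>, and with it the set of words not covered by the
  code, is invariant as well. This symmetry gives the second equation.
\<close>

lemma uncovered_and_antipodal_pair:
  fixes f :: "bit list \<Rightarrow> int"
  assumes identity: "\<And>x. x \<in> words n \<Longrightarrow>
      ball_sum (ball_sum f) x = 2 * f x + 2 * f (antipode x) + (int n - 1)"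
    and x: "x \<in> words n"
  defines "g \<equiv> \<lambda>x. 1 - ball_sum f x" and "a \<equiv> \<lambda>x. f x + f (antipode x)"
  shows "ball_sum g x + 2 * a x = 2" and "ball_sum a x + 2 * g x = 2"
proof -
  show "ball_sum g x + 2 * a x = 2"
    using identity[OF x] by (simp add: g_def a_def ball_sum_diff ball_sum_const[OF x])
  define d where "d = (\<lambda>x. f x - f (antipode x))"
  have ball_d: "ball_sum d y = ball_sum f y - ball_sum f (antipode y)" for y
    by (simp add: d_def ball_sum_diff ball_sum_antipode)
  have "ball_sum d = (\<lambda>y. ball_sum f y - ball_sum f (antipode y))"
    using ball_d by blast
  then have "ball_sum (ball_sum d) y = 0" if "y \<in> words n" for y
    using identity[of y] identity[of "antipode y"] that
      ball_sum_antipode[of "ball_sum f" y] by (simp add: ball_sum_diff)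
  then have "ball_sum d x = 0" by (rule ball_sum_eq_0_if_ball_sum_twice_eq_0[OF _ x])
  then have "ball_sum f (antipode x) = ball_sum f x" by (simp add: ball_d)
  then show "ball_sum a x + 2 * g x = 2"
    by (simp add: a_def g_def ball_sum_add ball_sum_antipode)
qed

text \<open>
  Double counting; \<open>n > 1\<close> is what makes the two totals equal, since summation leaves the equation
  \<open>(n - 1) A = (n - 1) G\<close>.
\<close>

lemma sum_of_paired_weights:
  assumes "n > 1"
    and 1: "\<And>x. x \<in> words n \<Longrightarrow> ball_sum \<alpha> x + 2 * \<gamma> x = 2"
    and 2: "\<And>x. x \<in> words n \<Longrightarrow> ball_sum \<gamma> x + 2 * \<alpha> x = 2"
  shows "(int n + 3) * (\<Sum>x\<in>words n. \<gamma> x) = 2 * 2 ^ n"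
proof -
  define A where "A = (\<Sum>x\<in>words n. \<alpha> x)"
  define G where "G = (\<Sum>x\<in>words n. \<gamma> x)"
  have "(\<Sum>x\<in>words n. ball_sum \<alpha> x + 2 * \<gamma> x) = (\<Sum>x\<in>words n. 2)"
    using 1 by (intro sum.cong) auto
  then have A: "(int n + 1) * A + 2 * G = 2 * 2 ^ n"
    by (simp add: sum.distrib sum_ball_sum card_words A_def G_def sum_distrib_left)
  have "(\<Sum>x\<in>words n. ball_sum \<gamma> x + 2 * \<alpha> x) = (\<Sum>x\<in>words n. 2)"
    using 2 by (intro sum.cong) auto
  then have G: "(int n + 1) * G + 2 * A = 2 * 2 ^ n"
    by (simp add: sum.distrib sum_ball_sum card_words A_def G_def sum_distrib_left)
  have "(int n - 1) * A = (int n - 1) * G"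
    using A G by (simp add: algebra_simps)
  then have "A = G" using assms(1) by simp
  then show ?thesis using A by (simp add: G_def algebra_simps)
qed

section \<open>Two additional coordinates\<close>

lemma words_add_2_cases:
  assumes "z \<in> words (n + 2)"
  obtains x p q where "x \<in> words n" "z = x @ [p, q]"
proof
  have len: "length z = n + 2" using assms by (simp add: words_def)
  show "take n z \<in> words n" using len by (simp add: words_def)
  show "z = take n z @ [z ! n, z ! Suc n]"
    using len by (intro nth_equalityI) (auto simp: nth_append nth_Cons' less_Suc_eq)
qed

lemma append_in_words_add_2: "x @ [p, q] \<in> words (n + 2) \<longleftrightarrow> x \<in> words n"
  by (simp add: words_def)

lemma word_add_last_two:
  "length x = n \<Longrightarrow> word_add (x @ [p, q]) (replicate n 0 @ [1, 1]) = x @ [p + 1, q + 1]"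
proof -
  assume "length x = n"
  moreover have "map2 (+) x (replicate (length x) 0) = x"
    by (intro nth_equalityI) auto
  ultimately show ?thesis by (auto simp: word_add_def)
qed

lemma ball_sum_append:
  assumes "x \<in> words n"
  shows "ball_sum F (x @ [p, q])
    = ball_sum (\<lambda>y. F (y @ [p, q])) x + F (x @ [p + 1, q]) + F (x @ [p, q + 1])"
proof -
  have len: "length x = n" using assms by (simp add: words_def)
  have "(\<Sum>i<n. F (flip i (x @ [p, q]))) = (\<Sum>i<n. F (flip i x @ [p, q]))"
    by (intro sum.cong) (auto simp: flip_append len)
  then show ?thesis
    using flip_append(2)[of x p "[q]"] flip_append(3)[of x p q "[]"]
    by (simp add: ball_sum_def len)
qed

lemma size_ball_mset:
  assumes "set_mset D \<subseteq> words n" "x \<in> words n"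
  shows "int (size {#y \<in># D. hamming x y \<le> 1#}) = ball_sum (\<lambda>y. int (count D y)) x"
proof -
  have "size {#y \<in># D. hamming x y \<le> 1#} = (\<Sum>y\<in>{y \<in> words n. hamming x y \<le> 1}. count D y)"
    unfolding size_multiset_overloaded_eq
    by (intro sum.mono_neutral_cong_left) (use assms in \<open>auto simp: not_in_iff\<close>)
  then show ?thesis using sum_over_ball[OF assms(2), of "\<lambda>y. int (count D y)"] by simp
qed

text \<open>
  The defining condition, read separately on the four layers given by the last two bits. In the ball
  around \<open>x @ [p, q]\<close> only the word itself and its flips in the first \<open>n\<close> positions stay in the layer
  of \<open>[p, q]\<close>; the other two words lie over \<open>x\<close> in the two layers next to it.
\<close>

lemma twofold_perfect_code_add_2_iff:
  assumes "set_mset D \<subseteq> words (n + 2)"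
  shows "twofold_perfect_code (n + 2) D \<longleftrightarrow> (\<forall>x\<in>words n. \<forall>p q.
    ball_sum (\<lambda>y. int (count D (y @ [p, q]))) x
      + int (count D (x @ [p + 1, q])) + int (count D (x @ [p, q + 1])) = 2)"
proof -
  have "twofold_perfect_code (n + 2) D \<longleftrightarrow>
      (\<forall>z\<in>words (n + 2). ball_sum (\<lambda>y. int (count D y)) z = 2)"
    unfolding twofold_perfect_code_def using assms
    by (auto simp flip: size_ball_mset[OF assms])
  also have "\<dots> \<longleftrightarrow> (\<forall>x\<in>words n. \<forall>p q. ball_sum (\<lambda>y. int (count D y)) (x @ [p, q]) = 2)"
    by (metis words_add_2_cases append_in_words_add_2)
  finally show ?thesis by (simp add: ball_sum_append)
qed

text \<open>
  The hypothesis concerns only membership, but multiplicities are forced to agree: if one of the two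
  words occurs, so does the other, and both are neighbours of \<open>x @ [p, q + 1]\<close>, whose ball has room
  for two codewords only. So each occurs exactly once.
\<close>

lemma invariant_twofold_code_layers:
  assumes D: "twofold_perfect_code (n + 2) D"
    and inv: "\<forall>z. z \<in># D \<longrightarrow> word_add z (replicate n 0 @ [1, 1]) \<in># D"
    and x: "x \<in> words n"
  shows "count D (x @ [p + 1, q + 1]) = count D (x @ [p, q])"
proof -
  have sub: "set_mset D \<subseteq> words (n + 2)" using D by (simp add: twofold_perfect_code_def)
  have len: "length x = n" using x by (simp add: words_def)
  have pos: "0 < count D (x @ [p + 1, q + 1])" if "0 < count D (x @ [p, q])" for p q
    using inv that word_add_last_two[OF len, of p q] by auto
  have "ball_sum (\<lambda>y. int (count D (y @ [p, q + 1]))) x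
      + int (count D (x @ [p + 1, q + 1])) + int (count D (x @ [p, q])) = 2"
    using D x unfolding twofold_perfect_code_add_2_iff[OF sub]
    by (metis bit_add_one_twice)
  moreover have "0 \<le> ball_sum (\<lambda>y. int (count D (y @ [p, q + 1]))) x"
    by (rule ball_sum_nonneg) simp
  moreover have "0 < count D (x @ [p, q]) \<longleftrightarrow> 0 < count D (x @ [p + 1, q + 1])"
    using pos[of p q] pos[of "p + 1" "q + 1", unfolded bit_add_one_twice] by (rule iffI)
  ultimately show ?thesis
    by (cases "0 < count D (x @ [p, q])") linarith+
qed

section \<open>Existence and uniqueness\<close>

lemma twofold_code_from_paired_weights:
  fixes a g :: "bit list \<Rightarrow> int"
  assumes a01: "\<And>x. x \<in> words n \<Longrightarrow> a x = 0 \<or> a x = 1"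
    and g01: "\<And>x. x \<in> words n \<Longrightarrow> g x = 0 \<or> g x = 1"
    and a: "\<And>x. x \<in> words n \<Longrightarrow> ball_sum a x + 2 * g x = 2"
    and g: "\<And>x. x \<in> words n \<Longrightarrow> ball_sum g x + 2 * a x = 2"
  obtains D where "twofold_perfect_code (n + 2) D"
    and "\<forall>z. z \<in># D \<longrightarrow> word_add z (replicate n 0 @ [1, 1]) \<in># D"
    and "\<And>x p q. x \<in> words n \<Longrightarrow> int (count D (x @ [p, q])) = (if p = q then a x else g x)"
proof
  define S where "S = {z. \<exists>x p q. z = x @ [p, q] \<and> x \<in> words n \<and> (if p = q then a x else g x) = 1}"
  have S_sub: "S \<subseteq> words (n + 2)" unfolding S_def by (auto simp: words_def)
  then have fin: "finite S" using finite_words finite_subset by blast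
  have in_S: "x @ [p, q] \<in> S \<longleftrightarrow> (if p = q then a x else g x) = 1" if "x \<in> words n" for x p q
    using that unfolding S_def by auto
  show count: "int (count (mset_set S) (x @ [p, q])) = (if p = q then a x else g x)"
    if "x \<in> words n" for x p q
    using a01[OF that] g01[OF that] in_S[OF that, of p q] fin by (auto split: if_splits)
  have ball: "ball_sum (\<lambda>y. int (count (mset_set S) (y @ [p, q]))) x
      = (if p = q then ball_sum a x else ball_sum g x)" if "x \<in> words n" for x p q
    using ball_sum_cong[OF count that] by auto
  show "twofold_perfect_code (n + 2) (mset_set S)"
  proof (subst twofold_perfect_code_add_2_iff)
    show "set_mset (mset_set S) \<subseteq> words (n + 2)" using S_sub fin by simp
    have "p + 1 = q \<longleftrightarrow> p \<noteq> q" "p = q + 1 \<longleftrightarrow> p \<noteq> q" for p q :: bit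
      by (cases p; cases q; simp)+
    then show "\<forall>x\<in>words n. \<forall>p q. ball_sum (\<lambda>y. int (count (mset_set S) (y @ [p, q]))) x
      + int (count (mset_set S) (x @ [p + 1, q])) + int (count (mset_set S) (x @ [p, q + 1])) = 2"
      using a g by (auto simp only: ball count) (auto simp: algebra_simps)
  qed
  show "\<forall>z. z \<in># mset_set S \<longrightarrow> word_add z (replicate n 0 @ [1, 1]) \<in># mset_set S"
  proof (intro allI impI)
    fix z assume "z \<in># mset_set S"
    then have z: "z \<in> S" using fin by simp
    then obtain x p q where x: "x \<in> words n" "z = x @ [p, q]"
      using S_sub words_add_2_cases by blast
    have "p + 1 = q + 1 \<longleftrightarrow> p = q" by (cases p; cases q; simp)
    then have "x @ [p + 1, q + 1] \<in> S" using z x in_S by simp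
    moreover have "length x = n" using x by (simp add: words_def)
    ultimately show "word_add z (replicate n 0 @ [1, 1]) \<in># mset_set S"
      using x(2) fin by (simp add: word_add_last_two)
  qed
qed

text \<open>
  The right-hand side depends only on \<open>f\<close>, so at most one invariant twofold code dominates \<open>f\<close> on
  the layer 00. The proof compares \<open>\<gamma>\<close> with \<open>1 - S f\<close>: pointwise it is at most that, and the totals
  agree.
\<close>

lemma count_of_twofold_code:
  fixes f :: "bit list \<Rightarrow> int"
  assumes n: "n > 1"
    and packing: "\<And>x. x \<in> words n \<Longrightarrow> ball_sum f x = 0 \<or> ball_sum f x = 1"
    and size: "(int n + 3) * (\<Sum>x\<in>words n. 1 - ball_sum f x) = 2 * 2 ^ n"
    and D: "twofold_perfect_code (n + 2) D"
    and inv: "\<forall>z. z \<in># D \<longrightarrow> word_add z (replicate n 0 @ [1, 1]) \<in># D"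
    and f: "\<And>x. x \<in> words n \<Longrightarrow> f x \<le> int (count D (x @ [0, 0]))"
    and x: "x \<in> words n"
  shows "int (count D (x @ [p, q])) = (if p = q then 1 - ball_sum (\<lambda>x. 1 - ball_sum f x) x div 2
    else 1 - ball_sum f x)"
proof -
  define \<alpha> where "\<alpha> = (\<lambda>x. int (count D (x @ [0, 0])))"
  define \<gamma> where "\<gamma> = (\<lambda>x. int (count D (x @ [0, 1])))"
  have sub: "set_mset D \<subseteq> words (n + 2)" using D by (simp add: twofold_perfect_code_def)
  note eq = D[unfolded twofold_perfect_code_add_2_iff[OF sub], rule_format]
  have \<alpha>: "ball_sum \<alpha> y + 2 * \<gamma> y = 2" and \<gamma>: "ball_sum \<gamma> y + 2 * \<alpha> y = 2"
    if y: "y \<in> words n" for y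
    using eq[OF y, of 0 0] eq[OF y, of 0 1]
      invariant_twofold_code_layers[OF D inv y, of 0 0]
      invariant_twofold_code_layers[OF D inv y, of 0 1]
    by (simp_all add: \<alpha>_def \<gamma>_def)
  have le: "\<gamma> y \<le> 1 - ball_sum f y" if y: "y \<in> words n" for y
  proof -
    have "ball_sum f y \<le> ball_sum \<alpha> y"
      using f y by (intro ball_sum_mono) (auto simp: \<alpha>_def)
    \<comment> \<open>The first equation only gives \<open>2 * \<gamma> y \<le> 2 - S f y\<close>; integrality of \<open>\<gamma>\<close> does the rest.\<close>
    then show ?thesis using \<alpha>[OF y] packing[OF y] by auto
  qed
  have "(int n + 3) * (\<Sum>x\<in>words n. \<gamma> x) = (int n + 3) * (\<Sum>x\<in>words n. 1 - ball_sum f x)"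
    using sum_of_paired_weights[OF n \<alpha> \<gamma>] size by simp
  then have "(\<Sum>x\<in>words n. \<gamma> x) = (\<Sum>x\<in>words n. 1 - ball_sum f x)" by simp
  then have \<gamma>_eq: "\<gamma> y = 1 - ball_sum f y" if "y \<in> words n" for y
    using sum_mono_inv[OF _ le that] by simp
  have "ball_sum \<gamma> x = ball_sum (\<lambda>x. 1 - ball_sum f x) x"
    using \<gamma>_eq x by (rule ball_sum_cong)
  then have \<alpha>_eq: "\<alpha> x = 1 - ball_sum (\<lambda>x. 1 - ball_sum f x) x div 2"
    using \<gamma>[OF x] by presburger
  show ?thesis
    using \<alpha>_eq \<gamma>_eq[OF x] invariant_twofold_code_layers[OF D inv x, of 0 0]
      invariant_twofold_code_layers[OF D inv x, of 0 1]
    by (cases p; cases q) (simp_all add: \<alpha>_def \<gamma>_def)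
qed

lemma code_distance_3_packing:
  assumes "C \<subseteq> words n" "\<And>y z. y \<in> C \<Longrightarrow> z \<in> C \<Longrightarrow> y \<noteq> z \<Longrightarrow> 3 \<le> hamming y z"
    and x: "x \<in> words n"
  shows "ball_sum (\<lambda>y. of_bool (y \<in> C)) x = 0 \<or> ball_sum (\<lambda>y. of_bool (y \<in> C)) x = 1"
proof -
  let ?K = "{y \<in> words n. hamming x y \<le> 1} \<inter> C"
  have "y = z" if "y \<in> ?K" "z \<in> ?K" for y z
  proof (rule ccontr)
    assume "y \<noteq> z"
    then have "3 \<le> hamming y z" using that assms(2) by blast
    moreover have "hamming y z \<le> hamming x y + hamming x z"
      using that x by (intro hamming_triangle) auto
    ultimately show False using that by simp
  qed
  then have "card ?K \<le> 1" using card_le_Suc0_iff_eq[of ?K] by simp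
  moreover have "ball_sum (\<lambda>y. of_bool (y \<in> C)) x = int (card ?K)"
    using sum_over_ball[OF x, of "\<lambda>y. of_bool (y \<in> C)"] by (simp add: Int_def)
  ultimately show ?thesis by linarith
qed

theorem theorem3:
  fixes m n :: nat and C1 :: "bit list set"
  assumes "m \<ge> 3"
    and "n = 2 ^ m - 3"
    and "is_code n (2 ^ (2 ^ m - m - 3)) 3 C1"
  shows "\<exists>!D. twofold_perfect_code (n + 2) D
            \<and> {x @ [0, 0] | x. x \<in> C1} \<subseteq> set_mset D
            \<and> (\<forall>x. x \<in># D \<longrightarrow> word_add x (replicate n 0 @ [1, 1]) \<in># D)"
proof -
  define f :: "bit list \<Rightarrow> int" where "f = (\<lambda>x. of_bool (x \<in> C1))"
  define g where "g = (\<lambda>x. 1 - ball_sum f x)"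
  define a where "a = (\<lambda>x. f x + f (antipode x))"
  have C1: "C1 \<subseteq> words n" "card C1 = 2 ^ (2 ^ m - m - 3)"
      "\<And>y z. y \<in> C1 \<Longrightarrow> z \<in> C1 \<Longrightarrow> y \<noteq> z \<Longrightarrow> 3 \<le> hamming y z"
    using assms(3) by (auto simp: is_code_def)
  obtain k where k: "m = k + 3" using assms(1) by (metis add.commute le_Suc_ex)
  define q where "q = (2::nat) ^ k"
  have q: "2 ^ m = 8 * q" "k < q" by (simp_all add: k q_def power_add)
  have n_q: "n = 8 * q - 3" using assms(2) q(1) by simp
  have n: "n + 3 = 2 ^ m" "n mod 4 = 1" "n > 1"
  proof -
    show "n + 3 = 2 ^ m" using n_q q by simp
    obtain r where "q = r + 1" using q(2) by (metis Suc_eq_plus1 less_imp_Suc_add)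
    then have "n = 8 * r + 5" using n_q by simp
    then show "n mod 4 = 1" "n > 1" by presburger+
  qed
  have f01: "f x = 0 \<or> f x = 1" for x by (simp add: f_def)
  have packing: "ball_sum f x = 0 \<or> ball_sum f x = 1" if "x \<in> words n" for x
    unfolding f_def by (rule code_distance_3_packing[OF C1(1) C1(3) that])
  have "m + (2 ^ m - m - 3) = n"
    using n_q q k by simp
  then have "2 ^ m * card C1 = 2 ^ n" by (simp add: C1(2) flip: power_add)
  then have "int (n + 3) * int (card C1) = 2 ^ n"
    unfolding n(1) by (metis of_nat_mult of_nat_numeral of_nat_power)
  moreover have "(\<Sum>x\<in>words n. f x) = int (card C1)"
    using C1(1) by (simp add: f_def Int_absorb1)
  ultimately have size: "(int n + 3) * (\<Sum>x\<in>words n. f x) = 2 ^ n" by simp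
  have identity: "ball_sum (ball_sum f) x = 2 * f x + 2 * f (antipode x) + (int n - 1)"
    if "x \<in> words n" for x
    using ball_sum_twice_extremal[OF n(2) f01 _ size that] packing by fastforce
  have g: "ball_sum g x + 2 * a x = 2" and a: "ball_sum a x + 2 * g x = 2"
    if "x \<in> words n" for x
    unfolding g_def a_def by (rule uncovered_and_antipodal_pair[OF identity that]; assumption)+
  have g01: "g x = 0 \<or> g x = 1" if "x \<in> words n" for x
    using packing[OF that] by (auto simp: g_def)
  \<comment> \<open>A codeword cannot be antipodal to a codeword: \<open>a x = 2\<close> would make \<open>S g x\<close> negative.\<close>
  have a01: "a x = 0 \<or> a x = 1" if "x \<in> words n" for x
  proof -
    have "ball_sum (\<lambda>_. 0) x \<le> ball_sum g x"
      using g01 that by (intro ball_sum_mono) fastforce+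
    then have "0 \<le> ball_sum g x" using ball_sum_const[OF that, of 0] by simp
    then show ?thesis using g[OF that] f01[of x] f01[of "antipode x"] by (auto simp: a_def)
  qed
  have g_size: "(int n + 3) * (\<Sum>x\<in>words n. 1 - ball_sum f x) = 2 * 2 ^ n"
    using sum_of_paired_weights[OF n(3) a g] by (simp add: g_def)
  obtain D where D: "twofold_perfect_code (n + 2) D"
    "\<forall>z. z \<in># D \<longrightarrow> word_add z (replicate n 0 @ [1, 1]) \<in># D"
    "\<And>x p q. x \<in> words n \<Longrightarrow> int (count D (x @ [p, q])) = (if p = q then a x else g x)"
    using twofold_code_from_paired_weights[OF a01 g01 a g] by blast
  show ?thesis
  proof (rule ex1I[of _ D], intro conjI)
    show "{x @ [0, 0] | x. x \<in> C1} \<subseteq> set_mset D"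
    proof safe
      fix x assume x: "x \<in> C1"
      then have "1 \<le> a x" using f01[of "antipode x"] by (auto simp: a_def f_def)
      then show "x @ [0, 0] \<in># D" using D(3)[of x 0 0] x C1(1) by (auto simp flip: count_greater_zero_iff)
    qed
  next
    fix D' assume D': "twofold_perfect_code (n + 2) D' \<and> {x @ [0, 0] | x. x \<in> C1} \<subseteq> set_mset D'
      \<and> (\<forall>x. x \<in># D' \<longrightarrow> word_add x (replicate n 0 @ [1, 1]) \<in># D')"
    have f_le: "f x \<le> int (count D' (x @ [0, 0]))" for x
    proof (cases "x \<in> C1")
      case True
      then have "0 < count D' (x @ [0, 0])" using D' by auto
      then show ?thesis by (simp add: f_def)
    qed (simp add: f_def)
    have count: "int (count D' (x @ [p, q])) = (if p = q then a x else g x)"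
      if "x \<in> words n" for x p q
    proof -
      have "int (count D' (x @ [p, q])) = (if p = q then 1 - ball_sum g x div 2 else g x)"
        unfolding g_def using D'
        by (intro count_of_twofold_code[OF n(3) packing g_size _ _ f_le that]) blast+
      moreover have "1 - ball_sum g x div 2 = a x" using g[OF that] by presburger
      ultimately show ?thesis by simp
    qed
    show "D' = D"
    proof (rule multiset_eqI)
      fix z
      show "count D' z = count D z"
      proof (cases "z \<in> words (n + 2)")
        case True
        then obtain x p q where "x \<in> words n" "z = x @ [p, q]" by (rule words_add_2_cases)
        then show ?thesis using count[of x p q] D(3)[of x p q] by simp
      next
        case False
        then have "z \<notin># D'" "z \<notin># D" using D' D(1) by (auto simp: twofold_perfect_code_def)
        then show ?thesis by (simp add: not_in_iff)
      qed
    qed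
  qed (use D in blast)+
qed

end
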